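(* Let $\ell \geq 6$ and $g\geq 3\ell -1$ be integers. Then $n(g, g-\ell)\geq \ell^2-3\ell+10$, where $n(g,t)$ denotes the number of numerical semigroups of genus $g$ and type $t$.
   Context: A numerical semigroup $\Lambda$ is a subset of $\mathbb{N}_0$ containing $0$, closed under addition, with finite complement in $\mathbb{N}_0$. The genus is $|\mathbb{N}_0\setminus\Lambda|$. The set of pseudo-Frobenius numbers is $PF(\Lambda)=\{x\in\mathbb{Z}\setminus\Lambda : x+\lambda\in\Lambda \text{ for all } \lambda\in\Lambda\setminus\{0\}\}$ and the type is $t(\Lambda)=|PF(\Lambda)|$. *)

theory Defs
  imports Main
begin

definition numerical_semigroup :: "nat set \<Rightarrow> bool" where
  "numerical_semigroup S \<longleftrightarrow>
     0 \<in> S \<and> (\<forall>a\<in>S. \<forall>b\<in>S. a + b \<in> S) \<and> finite (UNIV - S)"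

definition genus :: "nat set \<Rightarrow> nat" where
  "genus S = card (UNIV - S)"

(* Pseudo-Frobenius numbers are integers, not only naturals: for the full
   semigroup of all naturals the only one is -1. *)
definition pseudo_frobenius :: "nat set \<Rightarrow> int set" where
  "pseudo_frobenius S =
     {x. x \<notin> int ` S \<and> (\<forall>s \<in> S - {0}. x + int s \<in> int ` S)}"

definition semigroup_type :: "nat set \<Rightarrow> nat" where
  "semigroup_type S = card (pseudo_frobenius S)"

definition num_semigroups :: "nat \<Rightarrow> nat \<Rightarrow> nat" where
  "num_semigroups g t =
     card {S. numerical_semigroup S \<and> genus S = g \<and> semigroup_type S = t}"

end

theory Submission
  imports Defs
begin

text \<open>
  Fix a finite set \<open>A\<close> of positive integers and a multiplicity \<open>m > Max A\<close>. Removing \<open>m + A\<close> from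
  \<open>{0} \<union> {m..}\<close> leaves a semigroup, because sums of two nonzero elements are at least \<open>2 * m\<close>. A gap
  fails to be pseudo-Frobenius exactly if it is a positive difference \<open>a - j\<close> with \<open>a \<in> A\<close> and
  \<open>j \<notin> A\<close>, so the type is the genus minus the number of these differences. For \<open>g \<ge> 3 * l - 1\<close>
  every \<open>A\<close> with exactly \<open>l\<close> differences fits below the multiplicity \<open>g + 1 - card A\<close>, and it is
  enough to find many such \<open>A\<close>. If \<open>A \<subseteq> {1..l}\<close> contains \<open>l\<close> and, with each element \<open>x < l / 2\<close>, also
  \<open>l - x\<close>, then its differences are exactly \<open>1, \<dots>, l\<close>; this leaves three choices for each pair
  \<open>{x, l - x}\<close>, and powers of three beat the quadratic bound from \<open>l = 9\<close> on.
\<close>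

section \<open>Positive differences from elements of a set to non-elements\<close>

definition shifts :: "nat set \<Rightarrow> nat set" where
  "shifts A = (\<Union>a\<in>A. (\<lambda>j. a - j) ` ({..<a} - A))"

lemma mem_shifts: "x \<in> shifts A \<longleftrightarrow> 0 < x \<and> (\<exists>j. j \<notin> A \<and> x + j \<in> A)"
proof
  assume "x \<in> shifts A"
  then obtain a j where "a \<in> A" "j < a" "j \<notin> A" "x = a - j"
    by (auto simp: shifts_def)
  then show "0 < x \<and> (\<exists>j. j \<notin> A \<and> x + j \<in> A)"
    by (intro conjI exI[of _ j]) auto
next
  assume "0 < x \<and> (\<exists>j. j \<notin> A \<and> x + j \<in> A)"
  then obtain j where "0 < x" "j \<notin> A" "x + j \<in> A" by blast
  then show "x \<in> shifts A"
    unfolding shifts_def by (intro UN_I[of "x + j"] image_eqI[of _ _ j]) auto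
qed

lemma subset_shifts: "0 \<notin> A \<Longrightarrow> A \<subseteq> shifts A"
  by (metis add_0_right gr0I mem_shifts subsetI)

lemma finite_shifts: "finite A \<Longrightarrow> finite (shifts A)"
  by (simp add: shifts_def)

text \<open>The numbers \<open>j < a\<close> outside \<open>A\<close> give distinct differences
  \<open>a - j\<close>; those inside \<open>A\<close>, together with \<open>a\<close> itself, number
  at most \<open>card A\<close>.\<close>

lemma less_card_shifts_add_card:
  assumes "finite A" "a \<in> A"
  shows "a < card (shifts A) + card A"
proof -
  have "card ((\<lambda>j. a - j) ` ({..<a} - A)) = card ({..<a} - A)"
    by (intro card_image inj_onI) auto
  moreover have "(\<lambda>j. a - j) ` ({..<a} - A) \<subseteq> shifts A"
    using assms by (auto simp: shifts_def)
  ultimately have "card ({..<a} - A) \<le> card (shifts A)"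
    using card_mono finite_shifts assms(1) by metis
  moreover have "a \<le> card ({..<a} - A) + card ({..<a} \<inter> A)"
    using card_Int_Diff[of "{..<a}" A] by simp
  moreover have "card ({..<a} \<inter> A) < card A"
    using assms by (intro psubset_card_mono) auto
  ultimately show ?thesis by linarith
qed

section \<open>Finiteness for fixed genus\<close>

lemma gap_less_double_genus:
  assumes "numerical_semigroup S" "x \<notin> S"
  shows "x < 2 * genus S"
proof -
  let ?G = "UNIV - S"
  have fin: "finite ?G" using assms(1) by (simp add: numerical_semigroup_def)
  \<comment> \<open>Two members of \<open>S\<close> cannot add up to the gap \<open>x\<close>, so
    one of \<open>i\<close> and \<open>x - i\<close> is a gap.\<close>
  have "{..x} \<subseteq> ?G \<union> (\<lambda>i. x - i) ` ?G"
  proof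
    fix i assume i: "i \<in> {..x}"
    have "i \<notin> S \<or> x - i \<notin> S"
      using assms i unfolding numerical_semigroup_def by force
    then show "i \<in> ?G \<union> (\<lambda>i. x - i) ` ?G"
      using i by (auto intro!: image_eqI[of _ _ "x - i"])
  qed
  then have "card {..x} \<le> card (?G \<union> (\<lambda>i. x - i) ` ?G)"
    using fin by (intro card_mono) auto
  also have "\<dots> \<le> card ?G + card ?G"
    using card_Un_le[of ?G "(\<lambda>i. x - i) ` ?G"] card_image_le[OF fin, of "\<lambda>i. x - i"] by linarith
  finally show ?thesis by (simp add: genus_def)
qed

text \<open>\<open>card\<close> is 0 on infinite sets, so a lower bound for
  \<open>num_semigroups\<close> requires finiteness.\<close>

lemma finite_semigroups_of_genus: "finite {S. numerical_semigroup S \<and> genus S = g}"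
proof (rule finite_subset)
  show "{S. numerical_semigroup S \<and> genus S = g} \<subseteq> uminus ` Pow {..<2 * g}"
  proof
    fix S assume "S \<in> {S. numerical_semigroup S \<and> genus S = g}"
    then have "- S \<in> Pow {..<2 * g}" using gap_less_double_genus by auto
    then show "S \<in> uminus ` Pow {..<2 * g}"
      using image_eqI[of S uminus "- S"] by simp
  qed
qed simp

lemma pseudo_frobenius_nonneg:
  assumes "numerical_semigroup S" "S \<noteq> UNIV" "x \<in> pseudo_frobenius S"
  shows "0 \<le> x"
proof (rule ccontr)
  assume neg: "\<not> 0 \<le> x"
  let ?G = "UNIV - S"
  have G: "finite ?G" "?G \<noteq> {}" using assms by (auto simp: numerical_semigroup_def)
  \<comment> \<open>Lies beyond the largest gap, hence in \<open>S\<close>, but adding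
    \<open>x\<close> leads back to that gap.\<close>
  define s where "s = Max ?G + nat (- x)"
  have "s \<in> S - {0}"
    using Max_ge[OF G(1), of s] neg by (auto simp: s_def)
  then have "x + int s \<in> int ` S"
    using assms(3) by (auto simp: pseudo_frobenius_def)
  moreover have "x + int s = int (Max ?G)" using neg by (simp add: s_def)
  ultimately show False using Max_in[OF G] by auto
qed

section \<open>The semigroup attached to a multiplicity and a set\<close>

definition sg :: "nat \<Rightarrow> nat set \<Rightarrow> nat set" where
  "sg m A = insert 0 {m..} - (+) m ` A"

lemma mem_sg:
  "0 < m \<Longrightarrow> x \<in> sg m A \<longleftrightarrow> x = 0 \<or> (m \<le> x \<and> x - m \<notin> A)"
  by (auto simp: sg_def image_iff)

context
  fixes m :: nat and A :: "nat set"
  assumes m: "0 < m" and A: "A \<subseteq> {1..<m}"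
begin

lemma gaps_sg: "UNIV - sg m A = {1..<m} \<union> (+) m ` A"
  using m by (auto simp: sg_def)

lemma numerical_semigroup_sg: "numerical_semigroup (sg m A)"
proof -
  have "finite (UNIV - sg m A)"
    unfolding gaps_sg using finite_subset[OF A] by simp
  moreover have "a + b \<in> sg m A" if "a \<in> sg m A" "b \<in> sg m A" for a b
  proof (cases "a = 0 \<or> b = 0")
    case False
    then have "2 * m \<le> a + b" using that m by (auto simp: mem_sg)
    moreover from this have "a + b - m \<notin> A" using A by fastforce
    ultimately show ?thesis using m by (auto simp: mem_sg)
  qed (use that in auto)
  ultimately show ?thesis using m by (auto simp: numerical_semigroup_def mem_sg)
qed

lemma genus_sg: "genus (sg m A) = m - 1 + card A"
proof -
  have "{1..<m} \<inter> (+) m ` A = {}" by auto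
  then show ?thesis
    unfolding genus_def gaps_sg using finite_subset[OF A]
    by (simp add: card_Un_disjoint card_image)
qed

lemma shifts_subset_gaps: "shifts A \<subseteq> UNIV - sg m A"
proof
  fix x assume "x \<in> shifts A"
  then obtain j where "0 < x" "x + j \<in> A" by (auto simp: mem_shifts)
  then show "x \<in> UNIV - sg m A" using A by (auto simp: gaps_sg)
qed

text \<open>The nonzero elements of \<open>sg m A\<close> are the \<open>m + j\<close> with
  \<open>j \<notin> A\<close>, and \<open>x + m + j\<close> is missing exactly if
  \<open>x + j \<in> A\<close>.\<close>

lemma gap_add_mem_sg_iff:
  assumes "x \<notin> sg m A"
  shows "(\<forall>s\<in>sg m A - {0}. x + s \<in> sg m A) \<longleftrightarrow> x \<notin> shifts A"
proof -
  have x: "0 < x" using assms m by (auto simp: mem_sg)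
  have "(\<exists>s\<in>sg m A - {0}. x + s \<notin> sg m A) \<longleftrightarrow> (\<exists>j. j \<notin> A \<and> x + j \<in> A)"
  proof
    assume "\<exists>s\<in>sg m A - {0}. x + s \<notin> sg m A"
    then obtain s where "m \<le> s" "s - m \<notin> A" "x + s - m \<in> A"
      using m by (auto simp: mem_sg)
    then show "\<exists>j. j \<notin> A \<and> x + j \<in> A"
      by (intro exI[of _ "s - m"]) (auto simp: algebra_simps)
  next
    assume "\<exists>j. j \<notin> A \<and> x + j \<in> A"
    then obtain j where "j \<notin> A" "x + j \<in> A" by blast
    then show "\<exists>s\<in>sg m A - {0}. x + s \<notin> sg m A"
      using m x by (intro bexI[of _ "m + j"]) (auto simp: mem_sg algebra_simps)
  qed
  then show ?thesis using x by (auto simp: mem_shifts)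
qed

lemma semigroup_type_sg:
  assumes "1 < m"
  shows "semigroup_type (sg m A) = genus (sg m A) - card (shifts A)"
proof -
  have "sg m A \<noteq> UNIV"
  proof -
    have "1 \<notin> sg m A" using assms by (simp add: mem_sg)
    then show ?thesis by auto
  qed
  have int_mem: "int x \<in> pseudo_frobenius (sg m A) \<longleftrightarrow> x \<in> UNIV - sg m A - shifts A" for x
    using gap_add_mem_sg_iff[of x]
    by (auto simp: pseudo_frobenius_def inj_image_mem_iff simp flip: of_nat_add)
  have "pseudo_frobenius (sg m A) = int ` (UNIV - sg m A - shifts A)"
  proof (intro equalityI subsetI)
    fix x assume x: "x \<in> pseudo_frobenius (sg m A)"
    then have "0 \<le> x"
      using pseudo_frobenius_nonneg numerical_semigroup_sg \<open>sg m A \<noteq> UNIV\<close> by blast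
    then show "x \<in> int ` (UNIV - sg m A - shifts A)"
      using x int_mem[of "nat x"] by (intro image_eqI[of _ _ "nat x"]) auto
  qed (use int_mem in auto)
  then have "semigroup_type (sg m A) = card (UNIV - sg m A - shifts A)"
    by (simp add: semigroup_type_def card_image)
  also have "\<dots> = genus (sg m A) - card (shifts A)"
    unfolding genus_def using shifts_subset_gaps finite_shifts finite_subset[OF A]
    by (intro card_Diff_subset) auto
  finally show ?thesis .
qed

text \<open>As \<open>0 \<notin> A\<close>, \<open>m\<close> itself is not removed; hence the
  semigroup determines \<open>m\<close>, and then \<open>A\<close>.\<close>

lemma Least_sg: "(LEAST x. x \<in> sg m A \<and> 0 < x) = m"
  using m A by (intro Least_equality) (auto simp: mem_sg)

lemma recover_sg: "A = {j. m + j \<notin> sg m A}"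
  using m by (auto simp: mem_sg)

end

lemma sg_inject:
  assumes "sg m A = sg n B" "0 < m" "A \<subseteq> {1..<m}" "0 < n" "B \<subseteq> {1..<n}"
  shows "A = B"
proof -
  have "m = n" using Least_sg assms by metis
  then show ?thesis using recover_sg[of m] recover_sg[of n] assms by metis
qed

section \<open>From sets with \<open>l\<close> differences to semigroups\<close>

theorem card_le_num_semigroups:
  assumes C: "\<And>A. A \<in> C \<Longrightarrow> finite A \<and> 0 \<notin> A \<and> card (shifts A) = l"
    and l: "0 < l" and g: "3 * l - 1 \<le> g"
  shows "card C \<le> num_semigroups g (g - l)"
proof -
  \<comment> \<open>Forced by \<open>genus_sg\<close>: the genus \<open>m - 1 + card A\<close> has
    to be \<open>g\<close>.\<close>
  define mult where "mult A = g + 1 - card A" for A :: "nat set"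
  have A: "1 < mult A \<and> A \<subseteq> {1..<mult A} \<and> mult A - 1 + card A = g" if "A \<in> C" for A
  proof -
    have "finite A" "0 \<notin> A" "card (shifts A) = l" using C that by auto
    moreover from this have "card A \<le> l"
      using card_mono[OF finite_shifts subset_shifts] by blast
    \<comment> \<open>Here \<open>a < l + card A \<le> 2 * l\<close>, whereas
      \<open>g + 1 - card A \<ge> 3 * l - l\<close>.\<close>
    moreover have "a < mult A" if "a \<in> A" for a
      using less_card_shifts_add_card[OF \<open>finite A\<close> that] \<open>card A \<le> l\<close> \<open>card (shifts A) = l\<close> g
      unfolding mult_def by linarith
    ultimately show ?thesis
      using l g by (auto simp: mult_def Suc_le_eq intro: gr0I)
  qed
  have "inj_on (\<lambda>A. sg (mult A) A) C"
    by (intro inj_onI) (meson A less_trans sg_inject zero_less_one)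
  moreover have "(\<lambda>A. sg (mult A) A) ` C
      \<subseteq> {S. numerical_semigroup S \<and> genus S = g \<and> semigroup_type S = g - l}"
  proof safe
    fix A assume "A \<in> C"
    with A have m: "1 < mult A" "0 < mult A" "A \<subseteq> {1..<mult A}" and g': "mult A - 1 + card A = g"
      by fastforce+
    show "numerical_semigroup (sg (mult A) A)" by (rule numerical_semigroup_sg[OF m(2,3)])
    show "genus (sg (mult A) A) = g" using genus_sg[OF m(2,3)] g' by simp
    with semigroup_type_sg[OF m(2,3,1)] C[OF \<open>A \<in> C\<close>]
    show "semigroup_type (sg (mult A) A) = g - l" by simp
  qed
  moreover have "finite {S. numerical_semigroup S \<and> genus S = g \<and> semigroup_type S = g - l}"
    by (rule finite_subset[OF _ finite_semigroups_of_genus[of g]]) auto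
  ultimately show ?thesis
    unfolding num_semigroups_def by (rule card_inj_on_le)
qed

section \<open>Sets whose differences are exactly \<open>1\<close> to \<open>l\<close>\<close>

lemma shifts_eq_atLeastAtMost:
  assumes A: "A \<subseteq> {1..l}" "l \<in> A"
    and pair: "\<And>x. x \<in> A \<Longrightarrow> 2 * x < l \<Longrightarrow> l - x \<in> A"
  shows "shifts A = {1..l}"
proof (intro equalityI subsetI)
  fix x assume "x \<in> shifts A"
  then show "x \<in> {1..l}" using A by (fastforce simp: mem_shifts)
next
  fix x assume x: "x \<in> {1..l}"
  show "x \<in> shifts A"
  proof (rule ccontr)
    assume "x \<notin> shifts A"
    \<comment> \<open>If \<open>x\<close> is not a difference, \<open>A\<close> is closed under
      subtracting \<open>x\<close>. Descent from \<open>l\<close> reaches \<open>l mod x\<close>;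
      its partner is a multiple of \<open>x\<close>, from which descent reaches 0.\<close>
    then have step: "j \<in> A" if "x + j \<in> A" for j
      using that x by (auto simp: mem_shifts)
    have steps: "j \<in> A" if "k * x + j \<in> A" for k j
      using that by (induction k) (auto simp: add.assoc intro: step)
    have "l mod x \<in> A"
      using steps[of "l div x" "l mod x"] A by simp
    moreover have "2 * (l mod x) < l"
    proof -
      have "l mod x < x" "l = l div x * x + l mod x" "1 \<le> l div x"
        using x by (auto simp: div_greater_zero_iff Suc_le_eq)
      then have "x \<le> l div x * x" by simp
      then show ?thesis using \<open>l mod x < x\<close> \<open>l = _\<close> by linarith
    qed
    ultimately have "l - l mod x \<in> A" by (rule pair)
    then have "l div x * x + 0 \<in> A" by (simp add: minus_mod_eq_div_mult)
    then have "0 \<in> A" by (rule steps)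
    then show False using A by auto
  qed
qed

text \<open>Each element has three options: outside \<open>V\<close>, in \<open>V\<close> but not in
  \<open>U\<close>, or in \<open>U\<close>. The proof expands the product of the factors
  \<open>2 + 1\<close> over subsets.\<close>

lemma card_nested_pairs: "finite X \<Longrightarrow> card (SIGMA V:Pow X. Pow V) = 3 ^ card X"
proof -
  assume fin: "finite X"
  have "card (SIGMA V:Pow X. Pow V) = (\<Sum>V\<in>Pow X. 2 ^ card V)"
    using fin finite_subset by (subst card_SigmaI) (auto simp: card_Pow intro!: sum.cong)
  also have "\<dots> = (\<Prod>x\<in>X. 2 + 1)"
    using fin by (subst prod_add) auto
  finally show ?thesis by simp
qed

lemma card_ge_power3:
  assumes l: "2 * n < l"
  shows "3 ^ n \<le> card {A. A \<subseteq> {1..l} \<and> card (shifts A) = l}"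
proof -
  \<comment> \<open>\<open>V\<close> lists the \<open>x\<close> whose partner \<open>l - x\<close>
    is taken, \<open>U\<close> those taken themselves; \<open>U \<subseteq> V\<close> is the pair
    condition.\<close>
  define f where "f = (\<lambda>(V, U). insert l (U \<union> (\<lambda>x. l - x) ` V))"
  let ?P = "SIGMA V:Pow {1..n}. Pow V"
  \<comment> \<open>Since \<open>2 * n < l\<close>, the partners exceed \<open>n\<close> and cannot
    be confused with elements of \<open>U\<close>.\<close>
  have recover: "(V, U) = ({x\<in>{1..n}. l - x \<in> f (V, U)}, f (V, U) \<inter> {1..n})" if "(V, U) \<in> ?P" for U V
  proof -
    have VU: "V \<subseteq> {1..n}" "U \<subseteq> V" using that by auto
    then have bounds [simp]: "x \<in> V \<Longrightarrow> Suc 0 \<le> x" "x \<in> V \<Longrightarrow> x \<le> n"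
      "x \<in> U \<Longrightarrow> Suc 0 \<le> x" "x \<in> U \<Longrightarrow> x \<le> n" for x
      by fastforce+
    have "V = {x\<in>{1..n}. l - x \<in> f (V, U)}"
    proof (intro equalityI subsetI)
      fix x assume "x \<in> {x\<in>{1..n}. l - x \<in> f (V, U)}"
      then have x: "1 \<le> x" "x \<le> n" "l - x \<in> f (V, U)" by auto
      moreover have "l - x \<notin> U" using bounds(4)[of "l - x"] x(2) l by linarith
      ultimately obtain y where "y \<in> V" "l - x = l - y" using l by (auto simp: f_def)
      moreover from \<open>y \<in> V\<close> have "y \<le> n" by simp
      ultimately show "x \<in> V" using x l by (metis diff_diff_cancel le_trans less_imp_le mult_2 add_leD1)
    qed (auto simp: f_def)
    moreover have "U = f (V, U) \<inter> {1..n}"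
    proof (intro equalityI subsetI)
      fix x assume x: "x \<in> f (V, U) \<inter> {1..n}"
      have "x \<noteq> l - y" if "y \<in> V" for y
        using x l bounds(2)[OF that] by auto
      then show "x \<in> U" using x l by (auto simp: f_def)
    qed (auto simp: f_def)
    ultimately show ?thesis by blast
  qed
  have "inj_on f ?P"
    by (rule inj_on_inverseI[of _ "\<lambda>A. ({x\<in>{1..n}. l - x \<in> A}, A \<inter> {1..n})"])
      (use recover in auto)
  moreover have "f ` ?P \<subseteq> {A. A \<subseteq> {1..l} \<and> card (shifts A) = l}"
  proof
    fix A assume "A \<in> f ` ?P"
    then obtain V U where VU: "V \<subseteq> {1..n}" "U \<subseteq> V" "A = insert l (U \<union> (\<lambda>x. l - x) ` V)"
      by (auto simp: f_def)
    have sub: "A \<subseteq> {1..l}" using VU l by fastforce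
    moreover have "shifts A = {1..l}"
    proof (rule shifts_eq_atLeastAtMost[OF sub])
      fix x assume x: "x \<in> A" "2 * x < l"
      have "x \<noteq> l - y" if "y \<in> V" for y
        using x l VU that by fastforce
      then have "x \<in> U" using x VU by auto
      then show "l - x \<in> A" using VU by auto
    qed (use VU in simp)
    ultimately show "A \<in> {A. A \<subseteq> {1..l} \<and> card (shifts A) = l}" by simp
  qed
  moreover have "finite {A. A \<subseteq> {1..l} \<and> card (shifts A) = l}"
    by (rule finite_subset[of _ "Pow {1..l}"]) auto
  ultimately have "card ?P \<le> card {A. A \<subseteq> {1..l} \<and> card (shifts A) = l}"
    by (rule card_inj_on_le)
  then show ?thesis by (simp add: card_nested_pairs)
qed

text \<open>The left side is the target bound at \<open>l = 2 * n + 2\<close>. The base case is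
  tight: 80 against 81.\<close>

lemma quadratic_le_power3: "4 \<le> n \<Longrightarrow> 4 * n\<^sup>2 + 2 * n + 8 \<le> (3::nat) ^ n"
proof (induction n rule: dec_induct)
  case (step n)
  have "n \<le> n * n" by simp
  then have "4 * (Suc n)\<^sup>2 + 2 * Suc n + 8 \<le> 3 * (4 * n\<^sup>2 + 2 * n + 8)"
    unfolding power2_eq_square mult_Suc mult_Suc_right distrib_left by linarith
  then show ?case using step.IH by simp
qed simp

section \<open>Small values of \<open>l\<close> by enumeration\<close>

lemma card_filter_subseqs:
  assumes "distinct xs"
  shows "card {A. A \<subseteq> set xs \<and> P A} = length (filter (\<lambda>ys. P (set ys)) (subseqs xs))"
proof -
  have "{A. A \<subseteq> set xs \<and> P A} = set (filter P (map set (subseqs xs)))"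
    using subseqs_powset[of xs] by auto
  also have "card \<dots> = length (filter P (map set (subseqs xs)))"
    using distinct_set_subseqs[OF assms] by (intro distinct_card distinct_filter)
  finally show ?thesis by (simp add: filter_map o_def)
qed

text \<open>These are the target values for \<open>l = 6, 7, 8\<close>, where
  \<open>card_ge_power3\<close> gives only 9, 27 and 27. For 6 and 7 the sets may also contain
  \<open>l + 1\<close>.\<close>

lemma small_cases:
  "28 \<le> card {A. A \<subseteq> {1..7} \<and> card (shifts A) = 6}"
  "38 \<le> card {A. A \<subseteq> {1..8} \<and> card (shifts A) = 7}"
  "50 \<le> card {A. A \<subseteq> {1..8} \<and> card (shifts A) = 8}"
proof -
  have set_eq: "{1..7} = set [1..<8::nat]" "{1..8} = set [1..<9::nat]" by auto
  show "28 \<le> card {A. A \<subseteq> {1..7} \<and> card (shifts A) = 6}"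
    unfolding set_eq card_filter_subseqs[OF distinct_upt] shifts_def lessThan_atLeast0 by code_simp
  show "38 \<le> card {A. A \<subseteq> {1..8} \<and> card (shifts A) = 7}"
    unfolding set_eq card_filter_subseqs[OF distinct_upt] shifts_def lessThan_atLeast0 by code_simp
  show "50 \<le> card {A. A \<subseteq> {1..8} \<and> card (shifts A) = 8}"
    unfolding set_eq card_filter_subseqs[OF distinct_upt] shifts_def lessThan_atLeast0 by code_simp
qed

lemma quadratic_many_sets:
  assumes "6 \<le> l"
  shows "\<exists>k. l\<^sup>2 + 10 \<le> 3 * l + card {A. A \<subseteq> {1..k} \<and> card (shifts A) = l}"
proof -
  consider "l = 6" | "l = 7" | "l = 8" | "9 \<le> l" using assms by linarith
  then show ?thesis
  proof cases
    case 4
    \<comment> \<open>The number of pairs \<open>{x, l - x}\<close> with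
      \<open>0 < x < l / 2\<close>.\<close>
    define n where "n = (l - 1) div 2"
    have n: "4 \<le> n" "2 * n < l" "l = 2 * n + 1 \<or> l = 2 * n + 2" using 4 by (auto simp: n_def)
    have "l\<^sup>2 + 10 \<le> 3 * l + (4 * n\<^sup>2 + 2 * n + 8)"
      using n(3) by (auto simp: power2_eq_square algebra_simps)
    also have "\<dots> \<le> 3 * l + 3 ^ n" using quadratic_le_power3[OF n(1)] by simp
    also have "\<dots> \<le> 3 * l + card {A. A \<subseteq> {1..l} \<and> card (shifts A) = l}"
      using card_ge_power3[OF n(2)] by simp
    finally show ?thesis by blast
  next
    case 1
    then show ?thesis using small_cases(1) by (intro exI[of _ 7]) simp
  next
    case 2
    then show ?thesis using small_cases(2) by (intro exI[of _ 8]) simp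
  next
    case 3
    then show ?thesis using small_cases(3) by (intro exI[of _ 8]) simp
  qed
qed

theorem theorem3p10:
  fixes l g :: nat
  assumes "l \<ge> 6" and "g \<ge> 3 * l - 1"
  shows "int (num_semigroups g (g - l)) \<ge> (int l)\<^sup>2 - 3 * int l + 10"
proof -
  obtain k where "l\<^sup>2 + 10 \<le> 3 * l + card {A. A \<subseteq> {1..k} \<and> card (shifts A) = l}"
    using quadratic_many_sets[OF assms(1)] by blast
  also have "\<dots> \<le> 3 * l + num_semigroups g (g - l)"
    using assms by (intro add_left_mono card_le_num_semigroups) (auto intro: finite_subset)
  finally have "int (l\<^sup>2 + 10) \<le> int (3 * l + num_semigroups g (g - l))"
    by (simp only: of_nat_le_iff)
  then show ?thesis by simp
qed

end
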